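(* For any integers $t\ge s\ge 2$, $$\hat r_{\mathrm{edge}}(K_{s,t}^{\prec})\le e\,s^2\,2^{s+2}\,t ,$$ where $e$ is the base of the natural logarithm.
   Context: All graphs are finite, simple and undirected. An edge-ordered graph $G^{\prec}$ is a pair $(G,\prec)$ of a graph $G$ and a linear order $\prec$ on $E(G)$. $G^{\prec}$ is an edge-ordered subgraph of $H^{\prec}$ if $G$ is a subgraph of $H$ and the edge order of $G$ is the restriction of the edge order of $H$. Two edge-ordered graphs are isomorphic if there is a graph isomorphism whose induced map on edges preserves the edge orders. An edge-ordered copy of $G^{\prec}$ in $F^{\prec}$ is an edge-ordered subgraph of $F^{\prec}$ isomorphic to $G^{\prec}$. For edge-ordered graphs $G^{\prec},H^{\prec}$, the size edge-ordered Ramsey number $\hat r_{\mathrm{edge}}(G^{\prec},H^{\prec})$ is the minimum number $N$ such that there exists an edge-ordered graph $F^{\prec}$ with $N$ edges such that every red/blue coloring of the edges of $F^{\prec}$ contains a red edge-ordered copy of $G^{\prec}$ or a blue edge-ordered copy of $H^{\prec}$. Write $\hat r_{\mathrm{edge}}(G^{\prec})=\hat r_{\mathrm{edge}}(G^{\prec},G^{\prec})$. $K_{s,t}^{\prec}$ is the complete bipartite graph with partite sets $A=\{u_1,\dots,u_s\}$ and $B=\{v_1,\dots,v_t\}$ and the vertex-lexicographic edge order: $u_iv_j\prec u_kv_l$ iff $i<k$, or $i=k$ and $j<l$ (for $1\le i,k\le s$, $1\le j,l\le t$). *)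

theory Defs
  imports Complex_Main "HOL-Library.Extended_Real"
begin

text \<open>
  Edges are two-element vertex sets; \<open>edge_less\<close> is the strict version of the edge order,
  as a relation contained in \<open>edges \<times> edges\<close>.
\<close>

record 'a eo_graph =
  vertices :: "'a set"
  edges :: "'a set set"
  edge_less :: "'a set rel"

definition wf_eo_graph :: "'a eo_graph \<Rightarrow> bool" where
  "wf_eo_graph G \<longleftrightarrow>
     finite (vertices G) \<and>
     (\<forall>e\<in>edges G. e \<subseteq> vertices G \<and> card e = 2) \<and>
     edge_less G \<subseteq> edges G \<times> edges G \<and>
     strict_linear_order_on (edges G) (edge_less G)"

definition eo_subgraph :: "'a eo_graph \<Rightarrow> 'a eo_graph \<Rightarrow> bool" where
  "eo_subgraph G H \<longleftrightarrow>
     wf_eo_graph G \<and> vertices G \<subseteq> vertices H \<and> edges G \<subseteq> edges H \<and>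
     edge_less G = edge_less H \<inter> (edges G \<times> edges G)"

definition eo_isomorphic :: "'a eo_graph \<Rightarrow> 'b eo_graph \<Rightarrow> bool" where
  "eo_isomorphic G H \<longleftrightarrow>
     (\<exists>f. bij_betw f (vertices G) (vertices H) \<and>
        (\<forall>u\<in>vertices G. \<forall>v\<in>vertices G. {u, v} \<in> edges G \<longleftrightarrow> {f u, f v} \<in> edges H) \<and>
        (\<forall>d\<in>edges G. \<forall>e\<in>edges G. (d, e) \<in> edge_less G \<longleftrightarrow> (f ` d, f ` e) \<in> edge_less H))"

definition eo_copy :: "'b eo_graph \<Rightarrow> 'a eo_graph \<Rightarrow> 'b eo_graph \<Rightarrow> bool" where
  "eo_copy C G F \<longleftrightarrow> eo_subgraph C F \<and> eo_isomorphic G C"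

datatype colour = Red | Blue

text \<open>Only the values of the colouring \<open>c\<close> on \<open>edges F\<close> matter.\<close>

definition eo_arrows :: "'c eo_graph \<Rightarrow> 'a eo_graph \<Rightarrow> 'b eo_graph \<Rightarrow> bool" where
  "eo_arrows F G H \<longleftrightarrow>
     (\<forall>c :: 'c set \<Rightarrow> colour.
        (\<exists>C. eo_copy C G F \<and> (\<forall>e\<in>edges C. c e = Red)) \<or>
        (\<exists>C. eo_copy C H F \<and> (\<forall>e\<in>edges C. c e = Blue)))"

text \<open>
  Every finite graph is isomorphic to one on natural numbers, so taking the host graphs \<open>F\<close> over
  \<^typ>\<open>nat\<close> loses nothing. The infimum in \<^typ>\<open>enat\<close> is the minimum if some host graph exists
  and \<open>\<infinity>\<close> otherwise; with values in \<^typ>\<open>nat\<close> a missing host graph would yield an unspecified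
  number.
\<close>

definition size_eo_ramsey :: "'a eo_graph \<Rightarrow> 'b eo_graph \<Rightarrow> enat" where
  "size_eo_ramsey G H =
     Inf {enat (card (edges F)) |F :: nat eo_graph. wf_eo_graph F \<and> eo_arrows F G H}"

text \<open>The vertices \<open>u\<^sub>i\<close> and \<open>v\<^sub>j\<close> are \<^term>\<open>Inl i\<close> and \<^term>\<open>Inr j\<close>.\<close>

definition K_lex :: "nat \<Rightarrow> nat \<Rightarrow> (nat + nat) eo_graph" where
  "K_lex s t =
     \<lparr>vertices = Inl ` {1..s} \<union> Inr ` {1..t},
      edges = {{Inl i, Inr j} |i j. i \<in> {1..s} \<and> j \<in> {1..t}},
      edge_less = {({Inl i, Inr j}, {Inl k, Inr l}) |i j k l.
         i \<in> {1..s} \<and> k \<in> {1..s} \<and> j \<in> {1..t} \<and> l \<in> {1..t} \<and> (i < k \<or> i = k \<and> j < l)}\<rparr>"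

lemma wf_eo_graph_K_lex: "wf_eo_graph (K_lex s t)"
  unfolding wf_eo_graph_def K_lex_def strict_linear_order_on_def
  by (auto simp: trans_def irrefl_def total_on_def doubleton_eq_iff)

end

theory Submission
  imports Defs
begin

text \<open>
  The host graph is itself a lexicographically ordered complete bipartite graph \<open>K_lex m n\<close>.
  Restricting such a graph to \<open>s\<close> vertices on the left and \<open>t\<close> on the right gives again
  a lexicographic order, so every choice of the two vertex sets is an edge-ordered copy of
  \<open>K_lex s t\<close> (\<open>K_lex_copy_of_subsets\<close>). The edge order thus disappears from the
  problem: what is needed is a bipartite Ramsey statement with prescribed sides
  (\<open>mono_biclique\<close>), which is a double count of pairs consisting of a right vertex \<open>v\<close>
  and an \<open>s\<close>-subset of the left side all of whose edges to \<open>v\<close> have the same colour. Each \<open>v\<close>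
  has at least half of the left vertices in its majority colour, so with \<open>h = \<lceil>m / 2\<rceil>\<close>
  it lies in at least \<open>h choose s\<close> such pairs, and if \<open>n (h choose s)\<close> exceeds
  \<open>2 (m choose s) (t - 1)\<close> then some \<open>s\<close>-subset and some colour serve \<open>t\<close> right vertices.

  The choice \<open>m = s\<^sup>2\<close> makes the left side large enough for the loss in passing from \<open>m\<close> to
  half of it to be only \<open>(m choose s) \<le> e 2\<^sup>s (h choose s)\<close> (\<open>binomial_square_le_half\<close>).
  Hence \<open>n = \<lfloor>e 2\<^bsup>s+1\<^esup> t\<rfloor>\<close> right vertices suffice, and the host graph has
  \<open>s\<^sup>2 n\<close> edges. What remains is to move the host graph to the natural numbers, for which
  images of edge-ordered graphs under injections are used.
\<close>

section \<open>Images of edge-ordered graphs\<close>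

definition eo_image :: "('a \<Rightarrow> 'b) \<Rightarrow> 'a eo_graph \<Rightarrow> 'b eo_graph" where
  "eo_image f G =
     \<lparr>vertices = f ` vertices G, edges = (`) f ` edges G,
      edge_less = map_prod ((`) f) ((`) f) ` edge_less G\<rparr>"

lemma eo_image_simps [simp]:
  "vertices (eo_image f G) = f ` vertices G"
  "edges (eo_image f G) = (`) f ` edges G"
  "edge_less (eo_image f G) = map_prod ((`) f) ((`) f) ` edge_less G"
  by (simp_all add: eo_image_def)

lemma inj_on_edges:
  assumes "wf_eo_graph G" "inj_on f (vertices G)"
  shows "inj_on ((`) f) (edges G)"
proof (rule inj_onI)
  fix d e assume "d \<in> edges G" "e \<in> edges G" and eq: "f ` d = f ` e"
  then have "d \<subseteq> vertices G" "e \<subseteq> vertices G"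
    using assms(1) by (simp_all add: wf_eo_graph_def)
  then show "d = e"
    using inj_on_image_eq_iff[OF assms(2)] eq by blast
qed

lemma eo_image_less_iff:
  assumes "wf_eo_graph G" "inj_on f (vertices G)" "d \<in> edges G" "e \<in> edges G"
  shows "(f ` d, f ` e) \<in> edge_less (eo_image f G) \<longleftrightarrow> (d, e) \<in> edge_less G"
proof
  assume "(f ` d, f ` e) \<in> edge_less (eo_image f G)"
  then obtain d' e' where de: "(d', e') \<in> edge_less G" "f ` d = f ` d'" "f ` e = f ` e'"
    by auto
  then have "d' \<in> edges G" "e' \<in> edges G"
    using assms(1) by (auto simp: wf_eo_graph_def)
  then show "(d, e) \<in> edge_less G"
    using de inj_on_edges[OF assms(1,2)] assms(3,4) by (metis inj_onD)
qed force

lemma wf_eo_image: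
  assumes G: "wf_eo_graph G" and f: "inj_on f (vertices G)"
  shows "wf_eo_graph (eo_image f G)"
proof -
  have less: "edge_less G \<subseteq> edges G \<times> edges G"
    and tr: "trans (edge_less G)" and irr: "irrefl (edge_less G)"
    and tot: "total_on (edges G) (edge_less G)"
    using G by (auto simp: wf_eo_graph_def strict_linear_order_on_def)
  note iff = eo_image_less_iff[OF G f]
  have less': "edge_less (eo_image f G) \<subseteq> (`) f ` edges G \<times> (`) f ` edges G"
    using less by auto
  have "trans (edge_less (eo_image f G))"
  proof (rule transI)
    fix x y z assume xy: "(x, y) \<in> edge_less (eo_image f G)" and yz: "(y, z) \<in> edge_less (eo_image f G)"
    obtain a b where ab: "a \<in> edges G" "b \<in> edges G" "x = f ` a" "y = f ` b"
      using subsetD[OF less' xy] by blast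
    obtain c where c: "c \<in> edges G" "z = f ` c"
      using subsetD[OF less' yz] by blast
    have "(a, b) \<in> edge_less G" "(b, c) \<in> edge_less G"
      using xy yz iff[of a b] iff[of b c] ab c by (simp_all del: eo_image_simps)
    then have "(a, c) \<in> edge_less G"
      using tr by (blast dest: transD)
    then show "(x, z) \<in> edge_less (eo_image f G)"
      using iff[of a c] ab c by (simp del: eo_image_simps)
  qed
  moreover have "irrefl (edge_less (eo_image f G))"
  proof (rule irreflI)
    fix x show "(x, x) \<notin> edge_less (eo_image f G)"
    proof
      assume x: "(x, x) \<in> edge_less (eo_image f G)"
      obtain a where "a \<in> edges G" "x = f ` a"
        using subsetD[OF less' x] by blast
      then have "(a, a) \<in> edge_less G"
        using x iff[of a a] by (simp del: eo_image_simps)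
      then show False
        using irr by (simp add: irrefl_def)
    qed
  qed
  moreover have "total_on (edges (eo_image f G)) (edge_less (eo_image f G))"
  proof (rule total_onI)
    fix x y assume "x \<in> edges (eo_image f G)" "y \<in> edges (eo_image f G)" and ne: "x \<noteq> y"
    then obtain a b where ab: "a \<in> edges G" "b \<in> edges G" "x = f ` a" "y = f ` b"
      by auto
    then have "(a, b) \<in> edge_less G \<or> (b, a) \<in> edge_less G"
      using ne tot by (auto simp: total_on_def)
    then show "(x, y) \<in> edge_less (eo_image f G) \<or> (y, x) \<in> edge_less (eo_image f G)"
      using iff[of a b] iff[of b a] ab by (simp del: eo_image_simps)
  qed
  moreover have "f ` e \<subseteq> f ` vertices G \<and> card (f ` e) = 2" if "e \<in> edges G" for e
  proof -
    have "e \<subseteq> vertices G" "card e = 2"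
      using that G by (auto simp: wf_eo_graph_def)
    then show ?thesis
      using f by (auto simp: card_image inj_on_subset)
  qed
  moreover have "finite (f ` vertices G)"
    using G by (simp add: wf_eo_graph_def)
  ultimately show ?thesis
    using less' unfolding wf_eo_graph_def strict_linear_order_on_def
    by (simp del: eo_image_simps(3))
qed

lemma eo_isomorphic_eo_image:
  assumes G: "wf_eo_graph G" and f: "inj_on f (vertices G)"
  shows "eo_isomorphic G (eo_image f G)"
  unfolding eo_isomorphic_def
proof (intro exI[of _ f] conjI ballI)
  show "bij_betw f (vertices G) (vertices (eo_image f G))"
    using f by (simp add: bij_betw_def)
next
  fix u v assume uv: "u \<in> vertices G" "v \<in> vertices G"
  have "f ` {u, v} \<in> (`) f ` edges G \<longleftrightarrow> {u, v} \<in> edges G"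
  proof
    assume "f ` {u, v} \<in> (`) f ` edges G"
    then obtain e where e: "e \<in> edges G" "f ` {u, v} = f ` e" by blast
    moreover have "e \<subseteq> vertices G" using e(1) G by (auto simp: wf_eo_graph_def)
    ultimately have "{u, v} = e"
      using f uv by (meson empty_subsetI inj_on_image_eq_iff insert_subset)
    then show "{u, v} \<in> edges G" using e by simp
  qed blast
  then show "{u, v} \<in> edges G \<longleftrightarrow> {f u, f v} \<in> edges (eo_image f G)"
    by simp
next
  fix d e assume "d \<in> edges G" "e \<in> edges G"
  then show "(d, e) \<in> edge_less G \<longleftrightarrow> (f ` d, f ` e) \<in> edge_less (eo_image f G)"
    using eo_image_less_iff[OF G f, of d e] by blast
qed

lemma eo_isomorphic_trans:
  assumes G: "wf_eo_graph G" and GH: "eo_isomorphic G H" and HK: "eo_isomorphic H K"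
  shows "eo_isomorphic G K"
proof -
  obtain f where f: "bij_betw f (vertices G) (vertices H)"
    "\<forall>u\<in>vertices G. \<forall>v\<in>vertices G. {u, v} \<in> edges G \<longleftrightarrow> {f u, f v} \<in> edges H"
    "\<forall>d\<in>edges G. \<forall>e\<in>edges G. (d, e) \<in> edge_less G \<longleftrightarrow> (f ` d, f ` e) \<in> edge_less H"
    using GH unfolding eo_isomorphic_def by (elim exE conjE) (rule that)
  obtain g where g: "bij_betw g (vertices H) (vertices K)"
    "\<forall>u\<in>vertices H. \<forall>v\<in>vertices H. {u, v} \<in> edges H \<longleftrightarrow> {g u, g v} \<in> edges K"
    "\<forall>d\<in>edges H. \<forall>e\<in>edges H. (d, e) \<in> edge_less H \<longleftrightarrow> (g ` d, g ` e) \<in> edge_less K"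
    using HK unfolding eo_isomorphic_def by (elim exE conjE) (rule that)
  have fV: "f u \<in> vertices H" if "u \<in> vertices G" for u
    using f(1) that by (auto simp: bij_betw_def)
  have fE: "f ` e \<in> edges H" if "e \<in> edges G" for e
  proof -
    have "e \<subseteq> vertices G" "card e = 2"
      using that G by (auto simp: wf_eo_graph_def)
    then obtain u v where "e = {u, v}" "u \<in> vertices G" "v \<in> vertices G"
      by (auto simp: card_2_iff)
    then show ?thesis using f(2) that by auto
  qed
  show ?thesis
    unfolding eo_isomorphic_def
  proof (intro exI[of _ "g \<circ> f"] conjI ballI)
    show "bij_betw (g \<circ> f) (vertices G) (vertices K)"
      using f(1) g(1) by (rule bij_betw_trans)
  next
    fix u v assume "u \<in> vertices G" "v \<in> vertices G"
    then show "{u, v} \<in> edges G \<longleftrightarrow> {(g \<circ> f) u, (g \<circ> f) v} \<in> edges K"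
      using f(2) g(2) fV by simp
  next
    fix d e assume "d \<in> edges G" "e \<in> edges G"
    then have "(d, e) \<in> edge_less G \<longleftrightarrow> (g ` f ` d, g ` f ` e) \<in> edge_less K"
      using f(3) g(3) fE by simp
    then show "(d, e) \<in> edge_less G \<longleftrightarrow> ((g \<circ> f) ` d, (g \<circ> f) ` e) \<in> edge_less K"
      by (simp only: image_comp)
  qed
qed

lemma eo_copy_eo_image:
  assumes G: "wf_eo_graph G" and F: "wf_eo_graph F" and f: "inj_on f (vertices F)"
    and C: "eo_copy C G F"
  shows "eo_copy (eo_image f C) G (eo_image f F)"
proof -
  have wfC: "wf_eo_graph C" and sub: "vertices C \<subseteq> vertices F" "edges C \<subseteq> edges F"
    and less: "edge_less C = edge_less F \<inter> (edges C \<times> edges C)" and iso: "eo_isomorphic G C"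
    using C by (auto simp: eo_copy_def eo_subgraph_def)
  have fC: "inj_on f (vertices C)"
    using f sub(1) by (rule inj_on_subset)
  have "edge_less (eo_image f C) =
      edge_less (eo_image f F) \<inter> (edges (eo_image f C) \<times> edges (eo_image f C))" (is "?L = ?R")
  proof
    show "?L \<subseteq> ?R" using less by auto
    show "?R \<subseteq> ?L"
    proof clarify
      fix x y assume xy: "(x, y) \<in> edge_less (eo_image f F)"
        "x \<in> edges (eo_image f C)" "y \<in> edges (eo_image f C)"
      then obtain d e where de: "d \<in> edges C" "e \<in> edges C" "x = f ` d" "y = f ` e"
        by auto
      then have "(d, e) \<in> edge_less F"
        using xy(1) sub(2) eo_image_less_iff[OF F f, of d e] by blast
      then show "(x, y) \<in> edge_less (eo_image f C)"
        using de less by force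
    qed
  qed
  then have "eo_subgraph (eo_image f C) (eo_image f F)"
    using wf_eo_image[OF wfC fC] sub by (auto simp: eo_subgraph_def image_mono)
  then show ?thesis
    using eo_isomorphic_trans[OF G iso eo_isomorphic_eo_image[OF wfC fC]]
    by (simp add: eo_copy_def)
qed

lemma eo_arrows_eo_image:
  fixes f :: "'c \<Rightarrow> 'd"
  assumes "wf_eo_graph G" "wf_eo_graph H" "wf_eo_graph F" "inj_on f (vertices F)"
    and "eo_arrows F G H"
  shows "eo_arrows (eo_image f F) G H"
  unfolding eo_arrows_def
proof
  fix c :: "'d set \<Rightarrow> colour"
  have "(\<exists>C. eo_copy C G F \<and> (\<forall>e\<in>edges C. c (f ` e) = Red)) \<or>
        (\<exists>C. eo_copy C H F \<and> (\<forall>e\<in>edges C. c (f ` e) = Blue))"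
    using assms(5) unfolding eo_arrows_def by (rule spec[where x = "\<lambda>e. c (f ` e)"])
  then show "(\<exists>C. eo_copy C G (eo_image f F) \<and> (\<forall>e\<in>edges C. c e = Red)) \<or>
        (\<exists>C. eo_copy C H (eo_image f F) \<and> (\<forall>e\<in>edges C. c e = Blue))"
  proof (elim disjE exE conjE)
    fix C assume "eo_copy C G F" "\<forall>e\<in>edges C. c (f ` e) = Red"
    then show ?thesis
      using eo_copy_eo_image[OF assms(1,3,4)] by (intro disjI1 exI[of _ "eo_image f C"]) simp
  next
    fix C assume "eo_copy C H F" "\<forall>e\<in>edges C. c (f ` e) = Blue"
    then show ?thesis
      using eo_copy_eo_image[OF assms(2,3,4)] by (intro disjI2 exI[of _ "eo_image f C"]) simp
  qed
qed

text \<open>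
  A host graph may live on any type, since its finitely many vertices can be numbered.
\<close>

lemma size_eo_ramsey_le:
  assumes "wf_eo_graph G" "wf_eo_graph H" "wf_eo_graph F" "eo_arrows F G H"
  shows "size_eo_ramsey G H \<le> enat (card (edges F))"
proof -
  have "finite (vertices F)"
    using assms(3) by (simp add: wf_eo_graph_def)
  then obtain f :: "_ \<Rightarrow> nat" where f: "inj_on f (vertices F)"
    using finite_imp_inj_to_nat_seg by metis
  have "card (edges (eo_image f F)) = card (edges F)"
    using inj_on_edges[OF assms(3) f] by (simp add: card_image)
  then show ?thesis
    unfolding size_eo_ramsey_def
    using wf_eo_image[OF assms(3) f] eo_arrows_eo_image[OF assms(1-3) f assms(4)]
    by (intro Inf_lower) force
qed

section \<open>Lexicographically ordered complete bipartite graphs\<close>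

lemma edges_K_lex: "edges (K_lex s t) = (\<lambda>(i, j). {Inl i, Inr j}) ` ({1..s} \<times> {1..t})"
  by (auto simp: K_lex_def doubleton_eq_iff)

lemma card_edges_K_lex: "card (edges (K_lex m n)) = m * n"
proof -
  have "inj_on (\<lambda>(i, j). {Inl i, Inr j :: nat + nat}) ({1..m} \<times> {1..n})"
    by (auto simp: inj_on_def doubleton_eq_iff)
  then show ?thesis
    by (simp add: edges_K_lex card_image)
qed

lemma K_lex_less_iff:
  "({Inl i, Inr j}, {Inl k, Inr l}) \<in> edge_less (K_lex s t) \<longleftrightarrow>
     i \<in> {1..s} \<and> k \<in> {1..s} \<and> j \<in> {1..t} \<and> l \<in> {1..t} \<and> (i < k \<or> i = k \<and> j < l)"
  by (auto simp: K_lex_def doubleton_eq_iff)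

lemma ex_strict_mono_enumeration:
  fixes S :: "nat set"
  assumes "finite S"
  shows "\<exists>g. bij_betw g {1..card S} S \<and> strict_mono_on {1..card S} g"
proof -
  obtain g where g: "bij_betw g {..<card S} S" "strict_mono_on {..<card S} g"
    using ex_bij_betw_strict_mono_card[OF assms] .
  have "bij_betw (\<lambda>i. i - 1) {1..card S} {..<card S}"
    by (rule bij_betw_byWitness[where f' = Suc]) auto
  then have "bij_betw (g \<circ> (\<lambda>i. i - 1)) {1..card S} S"
    using g(1) by (rule bij_betw_trans)
  moreover have "strict_mono_on {1..card S} (g \<circ> (\<lambda>i. i - 1))"
    using strict_mono_onD[OF g(2)] by (intro strict_mono_onI) auto
  ultimately show ?thesis by blast
qed

text \<open>
  Enumerate both sets increasingly. The lexicographic comparison of two edges refers only to the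
  order among left and among right vertices, so the enumerations preserve it.
\<close>

lemma K_lex_copy_of_subsets:
  assumes S: "S \<subseteq> {1..m}" "card S = s" and T: "T \<subseteq> {1..n}" "card T = t"
  obtains C where "eo_copy C (K_lex s t) (K_lex m n)"
    "edges C = (\<lambda>(i, j). {Inl i, Inr j}) ` (S \<times> T)"
proof -
  have "finite S" "finite T"
    using S T finite_subset by blast+
  then obtain g h where g: "bij_betw g {1..s} S" "strict_mono_on {1..s} g"
    and h: "bij_betw h {1..t} T" "strict_mono_on {1..t} h"
    using ex_strict_mono_enumeration[of S] ex_strict_mono_enumeration[of T] S(2) T(2) by blast
  have gS: "g i \<in> S" if "i \<in> {1..s}" for i using g(1) that by (auto simp: bij_betw_def)
  have hT: "h j \<in> T" if "j \<in> {1..t}" for j using h(1) that by (auto simp: bij_betw_def)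
  let ?C = "eo_image (map_sum g h) (K_lex s t)"
  have gh: "inj_on g {1..s}" "inj_on h {1..t}" and range: "S = g ` {1..s}" "T = h ` {1..t}"
    using g(1) h(1) by (simp_all add: bij_betw_def)
  have inj: "inj_on (map_sum g h) (vertices (K_lex s t))"
    by (rule inj_onI) (auto simp: K_lex_def inj_on_eq_iff[OF gh(1)] inj_on_eq_iff[OF gh(2)])
  note wf = wf_eo_image[OF wf_eo_graph_K_lex inj]
  have edges_image: "edges ?C = (\<lambda>(i, j). {Inl (g i), Inr (h j)}) ` ({1..s} \<times> {1..t})"
    by (simp add: edges_K_lex image_image case_prod_unfold)
  have "S \<times> T = (\<lambda>(i, j). (g i, h j)) ` ({1..s} \<times> {1..t})"
    unfolding range by auto
  then have E: "edges ?C = (\<lambda>(i, j). {Inl i, Inr j}) ` (S \<times> T)"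
    unfolding edges_image by (simp add: image_image case_prod_unfold)
  have less: "({Inl (g i), Inr (h j)}, {Inl (g k), Inr (h l)}) \<in> edge_less ?C \<longleftrightarrow>
      ({Inl (g i), Inr (h j)}, {Inl (g k), Inr (h l)}) \<in> edge_less (K_lex m n)"
    if ijkl: "i \<in> {1..s}" "k \<in> {1..s}" "j \<in> {1..t}" "l \<in> {1..t}" for i j k l
  proof -
    have "{Inl i, Inr j} \<in> edges (K_lex s t)" "{Inl k, Inr l} \<in> edges (K_lex s t)"
      using ijkl by (auto simp: edges_K_lex)
    from eo_image_less_iff[OF wf_eo_graph_K_lex inj this]
    have "({Inl (g i), Inr (h j)}, {Inl (g k), Inr (h l)}) \<in> edge_less ?C \<longleftrightarrow>
        i < k \<or> i = k \<and> j < l"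
      unfolding K_lex_less_iff using ijkl by (simp del: eo_image_simps)
    moreover have "g i \<in> {1..m}" "g k \<in> {1..m}" "h j \<in> {1..n}" "h l \<in> {1..n}"
      using gS hT ijkl S(1) T(1) by blast+
    moreover have "g i < g k \<longleftrightarrow> i < k" "g i = g k \<longleftrightarrow> i = k" "h j < h l \<longleftrightarrow> j < l"
      using g(2) h(2) ijkl
      by (auto simp: strict_mono_on_less strict_mono_on_eq)
    ultimately show ?thesis
      unfolding K_lex_less_iff by (simp del: eo_image_simps)
  qed
  have "eo_subgraph ?C (K_lex m n)"
    unfolding eo_subgraph_def
  proof (intro conjI)
    show "wf_eo_graph ?C" by (rule wf)
    show "vertices ?C \<subseteq> vertices (K_lex m n)"
      using gS hT S(1) T(1) by (force simp: K_lex_def)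
    show "edges ?C \<subseteq> edges (K_lex m n)"
      unfolding E edges_K_lex using S(1) T(1) by (intro image_mono) auto
    show "edge_less ?C = edge_less (K_lex m n) \<inter> (edges ?C \<times> edges ?C)"
    proof (rule set_eqI, clarify)
      fix x y
      have sub: "edge_less ?C \<subseteq> edges ?C \<times> edges ?C"
        using wf by (simp only: wf_eo_graph_def)
      show "(x, y) \<in> edge_less ?C \<longleftrightarrow> (x, y) \<in> edge_less (K_lex m n) \<inter> (edges ?C \<times> edges ?C)"
      proof (cases "x \<in> edges ?C \<and> y \<in> edges ?C")
        case True
        then obtain i j k l where "x = {Inl (g i), Inr (h j)}" "y = {Inl (g k), Inr (h l)}"
          "i \<in> {1..s}" "k \<in> {1..s}" "j \<in> {1..t}" "l \<in> {1..t}"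
          unfolding edges_image by auto
        then show ?thesis using True less by (simp del: eo_image_simps)
      qed (use sub in blast)
    qed
  qed
  then have "eo_copy ?C (K_lex s t) (K_lex m n)"
    using eo_isomorphic_eo_image[OF wf_eo_graph_K_lex inj] by (simp add: eo_copy_def)
  then show thesis using E by (rule that)
qed

section \<open>Monochromatic bicliques with prescribed sides\<close>

lemma card_UNIV_colour: "card (UNIV :: colour set) = 2" "finite (UNIV :: colour set)"
proof -
  have UNIV_colour: "(UNIV :: colour set) = {Red, Blue}"
    using colour.exhaust by auto
  show "card (UNIV :: colour set) = 2" "finite (UNIV :: colour set)"
    unfolding UNIV_colour by simp_all
qed

text \<open>
  Double count the triples \<open>(S, k, v)\<close> such that all edges from the \<open>s\<close>-set \<open>S\<close> to \<open>v\<close> have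
  colour \<open>k\<close>. Every \<open>v\<close> has \<open>h\<close> neighbours in its majority colour and so lies in
  \<open>h choose s\<close> triples, while there are only \<open>2 (card A choose s)\<close> pairs \<open>(S, k)\<close>.
\<close>

lemma mono_biclique:
  fixes c :: "'a \<Rightarrow> 'b \<Rightarrow> colour"
  assumes A: "finite A" and B: "finite B" and h: "2 * h \<le> card A + 1"
    and count: "2 * (card A choose s) * (t - 1) < card B * (h choose s)"
  obtains S T k where "S \<subseteq> A" "card S = s" "T \<subseteq> B" "card T = t" "\<And>i j. i \<in> S \<Longrightarrow> j \<in> T \<Longrightarrow> c i j = k"
proof -
  define I where "I = {S. S \<subseteq> A \<and> card S = s} \<times> (UNIV :: colour set)"
  define R where "R = (\<lambda>(S, k) v. \<forall>i\<in>S. c i v = k)"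
  have I: "finite I" "card I = 2 * (card A choose s)"
    using A n_subsets[OF A, of s] card_UNIV_colour by (simp_all add: I_def)
  have per_vertex: "h choose s \<le> card {p \<in> I. R p v}" for v
  proof -
    have "{i \<in> A. c i v = Red} \<union> {i \<in> A. c i v = Blue} = A"
      using colour.exhaust by blast
    then have "card A \<le> card {i \<in> A. c i v = Red} + card {i \<in> A. c i v = Blue}"
      by (metis card_Un_le)
    then have "h \<le> card {i \<in> A. c i v = Red} \<or> h \<le> card {i \<in> A. c i v = Blue}"
      using h by linarith
    then obtain k where k: "h \<le> card {i \<in> A. c i v = k}"
      by blast
    have "h choose s \<le> card {i \<in> A. c i v = k} choose s"
      using k by (rule binomial_right_mono)
    also have "\<dots> = card {S. S \<subseteq> {i \<in> A. c i v = k} \<and> card S = s}"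
      using A by (simp add: n_subsets)
    also have "\<dots> = card ((\<lambda>S. (S, k)) ` {S. S \<subseteq> {i \<in> A. c i v = k} \<and> card S = s})"
      by (simp add: card_image inj_on_def)
    also have "\<dots> \<le> card {p \<in> I. R p v}"
      using I(1) by (intro card_mono) (auto simp: I_def R_def)
    finally show ?thesis .
  qed
  have "\<exists>p\<in>I. t \<le> card {v \<in> B. R p v}"
  proof (rule ccontr)
    assume "\<not> ?thesis"
    then have "card {v \<in> B. R p v} \<le> t - 1" if "p \<in> I" for p
      using that by fastforce
    then have upper: "(\<Sum>p\<in>I. card {v \<in> B. R p v}) \<le> card I * (t - 1)"
      using sum_bounded_above[of I "\<lambda>p. card {v \<in> B. R p v}" "t - 1"] by simp
    have "card B * (h choose s) \<le> (\<Sum>v\<in>B. card {p \<in> I. R p v})"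
      using sum_bounded_below[of B "h choose s"] per_vertex by simp
    also have "\<dots> = (\<Sum>p\<in>I. card {v \<in> B. R p v})"
      using sum_multicount_gen[OF I(1) B, of R "\<lambda>v. card {p \<in> I. R p v}"] by simp
    also note upper
    finally show False
      using count by (simp add: I(2))
  qed
  then obtain S k where Sk: "(S, k) \<in> I" "t \<le> card {v \<in> B. R (S, k) v}"
    by auto
  then obtain T where "T \<subseteq> {v \<in> B. R (S, k) v}" "card T = t"
    using obtain_subset_with_card_n by metis
  then show thesis
    using Sk(1) by (intro that[of S T k]) (auto simp: I_def R_def)
qed

lemma K_lex_arrows:
  assumes h: "2 * h \<le> m + 1" and count: "2 * (m choose s) * (t - 1) < n * (h choose s)"
  shows "eo_arrows (K_lex m n) (K_lex s t) (K_lex s t)"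
  unfolding eo_arrows_def
proof
  fix c :: "(nat + nat) set \<Rightarrow> colour"
  obtain S T k where ST: "S \<subseteq> {1..m}" "card S = s" "T \<subseteq> {1..n}" "card T = t"
    and mono: "\<And>i j. i \<in> S \<Longrightarrow> j \<in> T \<Longrightarrow> c {Inl i, Inr j} = k"
    using mono_biclique[of "{1..m}" "{1..n}" h s t "\<lambda>i j. c {Inl i, Inr j}"] assms by auto
  obtain C where C: "eo_copy C (K_lex s t) (K_lex m n)"
    "edges C = (\<lambda>(i, j). {Inl i, Inr j}) ` (S \<times> T)"
    using K_lex_copy_of_subsets[OF ST] by blast
  have "\<forall>e\<in>edges C. c e = k"
    using C(2) mono by auto
  then show "(\<exists>C. eo_copy C (K_lex s t) (K_lex m n) \<and> (\<forall>e\<in>edges C. c e = Red)) \<or>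
      (\<exists>C. eo_copy C (K_lex s t) (K_lex m n) \<and> (\<forall>e\<in>edges C. c e = Blue))"
    using C(1) by (cases k) auto
qed

section \<open>The size of the host graph\<close>

text \<open>
  The ratio of the binomial coefficients is the product of \<open>(s\<^sup>2 - i) / (h - i)\<close> over \<open>i < s\<close>.
  The factor for \<open>i = 0\<close> is at most \<open>2\<close>; every other one is at most
  \<open>2 (1 + 1 / (s - 1))\<close>, because \<open>i (s + 1) \<le> (s - 1) (s + 1) < s\<^sup>2\<close>. The \<open>s - 1\<close> extra
  factors multiply to at most \<open>e\<close>.
\<close>

lemma binomial_square_le_half:
  fixes s h :: nat
  assumes s: "2 \<le> s" and h: "s\<^sup>2 \<le> 2 * h"
  shows "real (s\<^sup>2 choose s) \<le> exp 1 * 2 ^ s * real (h choose s)"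
proof -
  have "s * 2 \<le> s * s" using s by (rule mult_le_mono2)
  then have s_le: "s \<le> h" "s \<le> s\<^sup>2"
    using h unfolding power2_eq_square by linarith+
  define r where "r = real s - 1"
  have r: "r \<ge> 1" using s by (simp add: r_def)
  have factor: "real (s\<^sup>2 - i) \<le> 2 * (1 + 1 / r) * real (h - i)" if "i \<in> {1..<s}" for i
  proof -
    have "real i * (real s + 1) \<le> (real s - 1) * (real s + 1)"
      using that s by (intro mult_right_mono) auto
    then have "real i * (real s + 1) \<le> (real s)\<^sup>2"
      by (simp add: algebra_simps power2_eq_square)
    then have "r * ((real s)\<^sup>2 - real i) \<le> (r + 1) * ((real s)\<^sup>2 - 2 * real i)"
      by (simp add: r_def algebra_simps)
    also have "\<dots> \<le> (r + 1) * (2 * (real h - real i))"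
    proof (rule mult_left_mono)
      have "real (s\<^sup>2) \<le> real (2 * h)" using h by (simp only: of_nat_le_iff)
      then show "(real s)\<^sup>2 - 2 * real i \<le> 2 * (real h - real i)" by simp
    qed (use r in simp)
    finally show ?thesis
      using that s_le r by (simp add: field_simps of_nat_diff)
  qed
  have s_split: "{0..<s} = insert 0 {1..<s}"
    using s by auto
  have "(\<Prod>i = 0..<s. real (s\<^sup>2 - i)) \<le> (2 * real h) * (\<Prod>i = 1..<s. 2 * (1 + 1 / r) * real (h - i))"
  proof -
    have "real (s\<^sup>2) \<le> real (2 * h)" using h by (simp only: of_nat_le_iff)
    moreover have "(\<Prod>i = 1..<s. real (s\<^sup>2 - i)) \<le> (\<Prod>i = 1..<s. 2 * (1 + 1 / r) * real (h - i))"
      using factor by (intro prod_mono) auto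
    ultimately show ?thesis
      unfolding s_split by (auto intro!: mult_mono prod_nonneg)
  qed
  also have "\<dots> = 2 ^ s * (1 + 1 / r) ^ (s - 1) * (\<Prod>i = 0..<s. real (h - i))"
  proof -
    have "(2 :: real) ^ s = 2 * 2 ^ (s - 1)"
      using s power_eq_if[of "2 :: real" s] by simp
    moreover have "(\<Prod>i = 1..<s. 2 * (1 + 1 / r) * real (h - i)) =
        2 ^ (s - 1) * (1 + 1 / r) ^ (s - 1) * (\<Prod>i = 1..<s. real (h - i))"
      by (simp only: prod.distrib prod_constant card_atLeastLessThan)
    ultimately show ?thesis
      unfolding s_split by simp
  qed
  also have "\<dots> \<le> 2 ^ s * exp 1 * (\<Prod>i = 0..<s. real (h - i))"
  proof (intro mult_right_mono mult_left_mono)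
    have "(1 + 1 / r) ^ (s - 1) \<le> exp (1 / r) ^ (s - 1)"
      using r by (intro power_mono exp_ge_add_one_self) auto
    also have "\<dots> = exp (real (s - 1) * (1 / r))"
      by (rule exp_of_nat_mult[symmetric])
    also have "real (s - 1) * (1 / r) = 1"
      using s by (simp add: r_def of_nat_diff)
    finally show "(1 + 1 / r) ^ (s - 1) \<le> exp 1" .
  qed (auto intro: prod_nonneg)
  finally have "(\<Prod>i = 0..<s. real (s\<^sup>2 - i)) / (\<Prod>i = 0..<s. real (s - i)) \<le>
      2 ^ s * exp 1 * (\<Prod>i = 0..<s. real (h - i)) / (\<Prod>i = 0..<s. real (s - i))"
    by (intro divide_right_mono prod_nonneg) auto
  then show ?thesis
    using s_le by (simp add: binomial_altdef_of_nat prod_dividef mult_ac)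
qed

theorem theorem3p7:
  fixes s t :: nat
  assumes "2 \<le> s" and "s \<le> t"
  shows "ereal_of_enat (size_eo_ramsey (K_lex s t) (K_lex s t))
           \<le> ereal (exp 1 * real s ^ 2 * 2 ^ (s + 2) * real t)"
proof -
  define x :: real where "x = exp 1 * 2 ^ (s + 1)"
  define n where "n = nat \<lfloor>x * real t\<rfloor>"
  define h where "h = (s\<^sup>2 + 1) div 2"
  have h: "2 * h \<le> s\<^sup>2 + 1" "s\<^sup>2 \<le> 2 * h"
    by (auto simp: h_def)
  have "s * 2 \<le> s * s" using assms(1) by (rule mult_le_mono2)
  then have "s \<le> h"
    using h(2) unfolding power2_eq_square by linarith
  then have pos: "0 < real (h choose s)"
    by simp
  have x: "1 < x"
    unfolding x_def by (intro less_1_mult one_less_power) auto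
  have n_le: "real n \<le> x * real t"
    using x by (simp add: n_def)
  \<comment> \<open>Rounding down is harmless because the count only needs to beat \<open>t - 1\<close>, and \<open>x > 1\<close>.\<close>
  have "x * real (t - 1) \<le> x * real t - 1 * x"
    using assms by (simp add: of_nat_diff algebra_simps)
  also have "\<dots> < real n"
    using x unfolding n_def by linarith
  finally have n_gt: "x * real (t - 1) < real n" .
  have "2 * real (s\<^sup>2 choose s) * real (t - 1) \<le>
      2 * (exp 1 * 2 ^ s * real (h choose s)) * real (t - 1)"
    using binomial_square_le_half[OF assms(1) h(2)] by (intro mult_right_mono mult_left_mono) auto
  also have "\<dots> = x * real (t - 1) * real (h choose s)"
    by (simp add: x_def)
  also have "\<dots> < real n * real (h choose s)"
    using n_gt pos by (rule mult_strict_right_mono)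
  finally have "real (2 * (s\<^sup>2 choose s) * (t - 1)) < real (n * (h choose s))"
    by simp
  then have "2 * (s\<^sup>2 choose s) * (t - 1) < n * (h choose s)"
    by (simp only: of_nat_less_iff)
  then have "eo_arrows (K_lex (s\<^sup>2) n) (K_lex s t) (K_lex s t)"
    using h(1) by (intro K_lex_arrows)
  then have "size_eo_ramsey (K_lex s t) (K_lex s t) \<le> enat (s\<^sup>2 * n)"
    using size_eo_ramsey_le[OF wf_eo_graph_K_lex wf_eo_graph_K_lex wf_eo_graph_K_lex]
    by (metis card_edges_K_lex)
  then have "ereal_of_enat (size_eo_ramsey (K_lex s t) (K_lex s t)) \<le> ereal (real (s\<^sup>2 * n))"
    by (metis ereal_of_enat_le_iff ereal_of_enat_simps(1))
  also have "real (s\<^sup>2 * n) \<le> (real s)\<^sup>2 * (x * real t)"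
    using n_le by (simp add: mult_left_mono)
  also have "\<dots> \<le> exp 1 * real s ^ 2 * 2 ^ (s + 2) * real t"
    by (simp add: x_def)
  finally show ?thesis
    by simp
qed

end
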